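(* Let $\tau_0 \ge 4$ (an integer) and $\psi \ge \max\left(\tau_0,\; 10^5 \sqrt{\tau_0-1}\, \log^3\tau_0\right)$ be constants. Let $G(\tau_0)$ be any graph with $\tau_0$ vertices and $\tau_0-1$ edges, and consider the preferential attachment process with initial graph $G(\tau_0)$ at time $\tau_0$. For $t\ge\tau_0$ and $\ell \ge 1$ let $U_t(\ell)$ be the number of vertices of degree at least $\ell$ at time $t$. Then, with probability at least $1-\frac{4}{\psi}$, we have $$ \left| U_t(\ell) - \frac{2t}{\ell(\ell+1)} \right| \le 45\, \frac{\sqrt{t \log (\psi t)}}{\ell} + 4 \times 10^9\, \psi \log^7(\psi t) $$ for all $\ell \ge 2$ and all $t \ge \tau_0$ (simultaneously).
   Context: Preferential attachment process: start at time $\tau_0$ with a graph $G(\tau_0)$ having $\tau_0$ vertices and $\tau_0-1$ edges. At each integer time $t>\tau_0$ a new vertex is created and joined by one new edge to one existing vertex; the existing vertex $v$ is chosen with probability proportional to its degree at time $t-1$ (i.e. with probability equal to its degree at time $t-1$ divided by $2(t-2)$, the sum of all degrees at time $t-1$), the choice depending on the past only through the current graph. Thus at each time $t\ge\tau_0$ the graph has $t$ vertices and $t-1$ edges. $\log$ is the natural logarithm and $\log^k x=(\log x)^k$. *)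

theory Defs
  imports "HOL-Probability.Probability" "HOL-Library.Uprod"
begin

text \<open>
  Finite undirected graphs. Parallel edges and loops are permitted, since nothing in the
  attachment process excludes them from the initial graph; simple graphs are the special case
  where the edge multiset has no repetitions and no pair \<open>Upair v v\<close>.
\<close>

datatype 'v graph = Graph (verts: "'v set") (edges: "'v uprod multiset")

definition fin_graph :: "'v graph \<Rightarrow> bool" where
  "fin_graph g \<longleftrightarrow> finite (verts g) \<and> (\<forall>e \<in># edges g. set_uprod e \<subseteq> verts g)"

text \<open>A loop contributes 2 to the degree of its vertex.\<close>

definition vdegree :: "'v graph \<Rightarrow> 'v \<Rightarrow> nat" where
  "vdegree g v = size {#e \<in># edges g. v \<in> set_uprod e#} + count (edges g) (Upair v v)"

definition attach :: "'v graph \<Rightarrow> 'v \<Rightarrow> 'v \<Rightarrow> 'v graph" where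
  "attach g x v = Graph (insert x (verts g)) (add_mset (Upair x v) (edges g))"

definition num_deg_ge :: "'v graph \<Rightarrow> nat \<Rightarrow> nat" where
  "num_deg_ge g l = card {v \<in> verts g. l \<le> vdegree g v}"

text \<open>
  The process is a sequence of random graphs \<open>G t\<close>, \<open>t \<ge> \<tau>0\<close>, on a probability space \<open>M\<close>;
  \<open>new t\<close> is the (fresh) vertex created at time \<open>t\<close>. The transition rule conditions on every
  history \<open>h\<close> of positive probability, and the right-hand side only involves the current graph
  \<open>h (t - 1)\<close>, which is the Markov property. If \<open>G0\<close> has \<open>\<tau>0\<close> vertices and \<open>\<tau>0 - 1\<close> edges,
  then the sum of all degrees in the denominator is \<open>2 * (t - 2)\<close>.
\<close>

locale preferential_attachment = prob_space M
  for M :: "'w measure" +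
  fixes \<tau>0 :: nat
    and G0 :: "'v graph"
    and new :: "nat \<Rightarrow> 'v"
    and G :: "nat \<Rightarrow> 'w \<Rightarrow> 'v graph"
  assumes new_inj: "inj_on new {\<tau>0<..}"
    and new_fresh: "\<And>t. t > \<tau>0 \<Longrightarrow> new t \<notin> verts G0"
    and random_graph: "\<And>t. t \<ge> \<tau>0 \<Longrightarrow> random_variable (count_space UNIV) (G t)"
    and initial: "AE \<omega> in M. G \<tau>0 \<omega> = G0"
    and step: "\<And>t h v. t > \<tau>0 \<Longrightarrow> v \<in> verts (h (t - 1)) \<Longrightarrow>
      \<P>(\<omega> in M. \<forall>s\<in>{\<tau>0..<t}. G s \<omega> = h s) > 0 \<Longrightarrow>
      \<P>(\<omega> in M. G t \<omega> = attach (h (t - 1)) (new t) v \<bar> \<forall>s\<in>{\<tau>0..<t}. G s \<omega> = h s) =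
        real (vdegree (h (t - 1)) v) / real (\<Sum>u\<in>verts (h (t - 1)). vdegree (h (t - 1)) u)"

end

theory Submission imports Defs begin

text \<open>
  The degree of a single vertex is a Markov chain. Let \<open>q\<^sub>t(d)\<close> be the probability that a
  vertex of degree \<open>d\<close> at time \<open>t\<close> has degree at least \<open>l\<close> at the final time \<open>T\<close>, and let \<open>c = e\<^sup>\<theta> - 1\<close>. Since only one vertex
  changes its degree in each step, the product of the factors \<open>1 + c q\<^sub>t(d)\<close> over all vertices is a
  supermartingale, up to the factor of the new vertex: this is the inequality
  \<open>1 + \<Sum> y\<^sub>v \<le> \<Prod> (1 + y\<^sub>v)\<close> for \<open>y\<^sub>v \<ge> -1\<close> of equal sign, and \<open>q\<^sub>t\<close> is monotone. Hence
  the moment generating function of \<open>U\<^sub>T(l)\<close> is bounded as if the vertices were independent, for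
  both signs of \<open>\<theta>\<close>, and Chernoff bounds hold around the mean. The mean satisfies a recursion in
  \<open>T\<close> that is solved exactly by \<open>2 (T - 1) / (l (l + 1))\<close> and does not expand the error made at time
  \<open>\<tau>0\<close>, which is at most \<open>\<tau>0\<close>. A union bound over \<open>l \<le> 2 t\<close> and all \<open>t\<close> finishes the proof,
  because larger degrees do not occur.
\<close>

subsection \<open>Degrees\<close>

lemma vdegree_sum:
  assumes "fin_graph g"
  shows "(\<Sum>v\<in>verts g. vdegree g v) = 2 * size (edges g)"
proof -
  \<comment> \<open>\<open>V\<close> is decoupled from the graph so that edges can be added one at a
    time over a fixed vertex set. Each edge adds one at either end; for a loop both indicators below
    fire at the same vertex.\<close>
  have "(\<Sum>v\<in>V. size {#e \<in># E. v \<in> set_uprod e#} + count E (Upair v v)) = 2 * size E"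
    if "finite V" "\<forall>e\<in>#E. set_uprod e \<subseteq> V" for V :: "'a set" and E
    using that(2)
  proof (induction E)
    case (add e E)
    obtain a b where e: "e = Upair a b" by (cases e)
    have ab: "a \<in> V" "b \<in> V" using add.prems e by auto
    have "(\<Sum>v\<in>V. size {#e' \<in># add_mset e E. v \<in> set_uprod e'#} + count (add_mset e E) (Upair v v))
        = (\<Sum>v\<in>V. (size {#e' \<in># E. v \<in> set_uprod e'#} + count E (Upair v v))
            + (of_bool (v = a) + of_bool (v = b)))"
      using e by (intro sum.cong) auto
    also have "\<dots> = 2 * size E + ((\<Sum>v\<in>V. of_bool (v = a)) + (\<Sum>v\<in>V. of_bool (v = b)))"
      using add by (simp add: sum.distrib)
    also have "\<dots> = 2 * size (add_mset e E)"
      using ab \<open>finite V\<close> by (simp add: of_bool_def)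
    finally show ?case .
  qed simp
  from this[of "verts g" "edges g"] show ?thesis
    using assms by (auto simp: fin_graph_def vdegree_def)
qed

lemma vdegree_le:
  assumes "fin_graph g" "v \<in> verts g"
  shows "vdegree g v \<le> 2 * size (edges g)"
  using member_le_sum[of v "verts g" "vdegree g"] assms
  by (simp add: vdegree_sum[OF assms(1), symmetric] fin_graph_def)

lemma vdegree_attach_old:
  assumes "x \<notin> verts g" "u \<in> verts g"
  shows "vdegree (attach g x v) u = vdegree g u + of_bool (u = v)"
  using assms by (auto simp: vdegree_def attach_def)

lemma vdegree_attach_new:
  assumes "fin_graph g" "x \<notin> verts g" "v \<in> verts g"
  shows "vdegree (attach g x v) x = 1"
proof -
  have "{#e \<in># edges g. x \<in> set_uprod e#} = {#}" "Upair x x \<notin># edges g"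
    using assms by (fastforce simp: fin_graph_def)+
  with assms show ?thesis by (auto simp: vdegree_def attach_def not_in_iff)
qed

lemma fin_graph_attach:
  "fin_graph g \<Longrightarrow> v \<in> verts g \<Longrightarrow> fin_graph (attach g x v)"
  by (auto simp: fin_graph_def attach_def)

lemma attach_inj: "attach g x v = attach g x v' \<longleftrightarrow> v = v'"
  by (auto simp: attach_def)

text \<open>When \<open>i\<close> is inserted, the new product exceeds \<open>?P + y i\<close> by
  \<open>y i * (?P - 1)\<close>. This is non-negative: all factors lie on the same side of 1, so
  \<open>?P - 1\<close> has the sign of \<open>y i\<close>.\<close>

lemma one_plus_sum_le_prod:
  fixes y :: "'a \<Rightarrow> real"
  assumes "finite A" "(\<forall>i\<in>A. 0 \<le> y i) \<or> (\<forall>i\<in>A. -1 \<le> y i \<and> y i \<le> 0)"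
  shows "1 + (\<Sum>i\<in>A. y i) \<le> (\<Prod>i\<in>A. 1 + y i)"
  using assms
proof (induction A)
  case (insert i A)
  let ?P = "\<Prod>i\<in>A. 1 + y i"
  have IH: "1 + (\<Sum>i\<in>A. y i) \<le> ?P" using insert by auto
  have "0 \<le> y i * (?P - 1)"
  proof (cases "\<forall>i\<in>insert i A. 0 \<le> y i")
    case True
    then have "1 \<le> ?P" by (intro prod_ge_1) auto
    then show ?thesis using True by simp
  next
    case False
    then have *: "\<forall>i\<in>insert i A. -1 \<le> y i \<and> y i \<le> 0" using insert.prems by blast
    then have "?P \<le> 1" by (intro prod_le_1) auto
    then show ?thesis using * by (simp add: mult_nonpos_nonpos)
  qed
  then show ?case using IH insert.hyps by (simp add: algebra_simps)
qed simp

subsection \<open>The degree of a single vertex\<close>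

text \<open>The minimum with 1 is inactive for degrees that occur; it keeps unreachable ones in range.\<close>

definition pick :: "nat \<Rightarrow> nat \<Rightarrow> real" where
  "pick t d = min 1 (real d / (2 * (real t - 1)))"

lemma pick_01: "1 \<le> t \<Longrightarrow> 0 \<le> pick t d \<and> pick t d \<le> 1"
  by (simp add: pick_def)

text \<open>
  \<open>reach l t n d\<close> is the probability that a vertex of degree \<open>d\<close> at time \<open>t\<close> has degree at least
  \<open>l\<close> at time \<open>t + n\<close>.
\<close>

fun reach :: "nat \<Rightarrow> nat \<Rightarrow> nat \<Rightarrow> nat \<Rightarrow> real" where
  "reach l t 0 d = of_bool (l \<le> d)"
| "reach l t (Suc n) d =
    pick t d * reach l (Suc t) n (Suc d) + (1 - pick t d) * reach l (Suc t) n d"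

lemma reach_01: "1 \<le> t \<Longrightarrow> 0 \<le> reach l t n d \<and> reach l t n d \<le> 1"
proof (induction n arbitrary: t d)
  case (Suc n)
  show ?case
    using pick_01[OF Suc.prems, of d] Suc.IH[of "Suc t" d] Suc.IH[of "Suc t" "Suc d"]
    by (auto intro!: convex_bound_le)
qed simp

text \<open>One step up from \<open>d\<close> lands at most at \<open>Suc d\<close>, so the mixture
  from \<open>d\<close> is at most \<open>?r (Suc d)\<close>. A mixture of two equal values does not
  depend on the weights, which can therefore be exchanged for those of \<open>Suc d\<close> before
  the value is raised again.\<close>

lemma reach_mono_Suc: "1 \<le> t \<Longrightarrow> reach l t n d \<le> reach l t n (Suc d)"
proof (induction n arbitrary: t d)
  case (Suc n)
  let ?r = "reach l (Suc t) n"
  have "reach l t (Suc n) d \<le> pick t d * ?r (Suc d) + (1 - pick t d) * ?r (Suc d)"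
    using pick_01[OF Suc.prems, of d] Suc.IH[of "Suc t" d] by (auto intro!: mult_left_mono)
  also have "\<dots> = pick t (Suc d) * ?r (Suc d) + (1 - pick t (Suc d)) * ?r (Suc d)"
    by (simp add: algebra_simps)
  also have "\<dots> \<le> reach l t (Suc n) (Suc d)"
    using pick_01[OF Suc.prems, of "Suc d"] Suc.IH[of "Suc t" "Suc d"]
    by (auto intro!: mult_left_mono)
  finally show ?case .
qed simp

lemma reach_eq_0: "d + n < l \<Longrightarrow> reach l t n d = 0"
  by (induction n arbitrary: t d) auto

text \<open>The forward equation: condition on the last step instead of the first.\<close>

lemma reach_forward:
  "reach (Suc l) t (Suc n) d
    = pick (t + n) l * reach l t n d + (1 - pick (t + n) l) * reach (Suc l) t n d"
proof (induction n arbitrary: t d)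
  case 0
  \<comment> \<open>A single step matters only from \<open>d = l\<close>, where both sides use the
    same \<open>pick\<close>; from other degrees both sides are 0 or both are 1.\<close>
  then show ?case by (cases "l = d") auto
next
  case (Suc n)
  show ?case
    unfolding reach.simps(2)[of "Suc l" t "Suc n"] Suc.IH[of "Suc t"] by (simp add: algebra_simps)
qed

section \<open>The mean count and its recursion in time\<close>

text \<open>The second sum runs over the vertices created at times \<open>t + Suc i\<close>, which start with degree 1.\<close>

definition mean_count :: "'v graph \<Rightarrow> nat \<Rightarrow> nat \<Rightarrow> nat \<Rightarrow> real" where
  "mean_count g t l n =
    (\<Sum>v\<in>verts g. reach l t n (vdegree g v)) + (\<Sum>i<n. reach l (t + Suc i) (n - Suc i) 1)"

text \<open>This is \<open>reach_forward\<close> summed over all vertices. The vertex born in the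
  last step has degree 1 and no steps left, which gives the summand
  \<open>of_bool (l = 0)\<close>.\<close>

lemma mean_count_Suc:
  "mean_count g t (Suc l) (Suc n) = of_bool (l = 0)
    + pick (t + n) l * mean_count g t l n + (1 - pick (t + n) l) * mean_count g t (Suc l) n"
proof -
  have "(\<Sum>i<n. reach (Suc l) (t + Suc i) (Suc n - Suc i) 1)
    = (\<Sum>i<n. pick (t + n) l * reach l (t + Suc i) (n - Suc i) 1
        + (1 - pick (t + n) l) * reach (Suc l) (t + Suc i) (n - Suc i) 1)"
  proof (rule sum.cong)
    fix i assume "i \<in> {..<n}"
    then have "Suc n - Suc i = Suc (n - Suc i)" "t + Suc i + (n - Suc i) = t + n" by auto
    then show "reach (Suc l) (t + Suc i) (Suc n - Suc i) 1
        = pick (t + n) l * reach l (t + Suc i) (n - Suc i) 1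
          + (1 - pick (t + n) l) * reach (Suc l) (t + Suc i) (n - Suc i) 1"
      using reach_forward[of l "t + Suc i" "n - Suc i" 1] by simp
  qed simp
  then show ?thesis
    unfolding mean_count_def reach_forward sum.lessThan_Suc
    by (simp add: sum.distrib distrib_left del: reach.simps(2) flip: sum_distrib_left)
qed

lemma mean_count_approx:
  assumes "1 \<le> t" "card (verts g) = t"
  shows "\<bar>mean_count g t (Suc l) n - 2 * (real (t + n) - 1) / ((real l + 1) * (real l + 2))\<bar> \<le> t"
proof -
  have init: "0 \<le> (\<Sum>v\<in>verts g. reach k t n (vdegree g v))"
    "(\<Sum>v\<in>verts g. reach k t n (vdegree g v)) \<le> t" for k n
    using sum_bounded_above[of "verts g" "\<lambda>v. reach k t n (vdegree g v)" 1] reach_01[OF assms(1)]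
      assms by (auto intro!: sum_nonneg)
  \<comment> \<open>The index is shifted: \<open>r s k\<close> is the target for degree at least
    \<open>Suc k\<close>. The factor \<open>real s - 1\<close>, the number of edges at time
    \<open>s\<close>, makes the recursion exact; with \<open>real s\<close> it would not be.\<close>
  define r where "r s k = 2 * (real s - 1) / ((real k + 1) * (real k + 2))" for s k :: nat
  have "\<bar>mean_count g t (Suc l) n - r (t + n) l\<bar> \<le> t"
  proof (induction n arbitrary: l)
    case 0
    have "0 \<le> mean_count g t (Suc l) 0" "mean_count g t (Suc l) 0 \<le> t"
      using init[where k="Suc l" and n=0] by (simp_all add: mean_count_def)
    moreover have "r t l \<le> 2 * (real t - 1) / (1 * 2)"
      unfolding r_def using assms by (intro divide_left_mono mult_mono) auto
    moreover have "0 \<le> r t l" using assms by (simp add: r_def)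
    ultimately show ?case by (simp add: abs_le_iff)
  next
    case (Suc n)
    let ?p = "pick (t + n) l"
    \<comment> \<open>For \<open>l = 0\<close> all vertices are counted and both quantities grow by
      1. In the middle range the minimum in \<open>pick\<close> is inactive and the recursion for
      \<open>r\<close> is exact. For larger \<open>l\<close> no later vertex can have reached
      \<open>Suc l\<close>, so the mean comes from the initial vertices alone and lies in
      \<open>[0, t]\<close>, while \<open>r\<close> is at most 1.\<close>
    consider "l = 0" | "l \<noteq> 0" "l \<le> 2 * (t + n - 1)" | "l > 2 * (t + n - 1)" by linarith
    then show ?case
    proof cases
      case 1
      then show ?thesis using Suc[of 0] by (simp add: mean_count_Suc r_def pick_def diff_divide_distrib add_divide_distrib)
    next
      case 2
      then obtain k where k: "l = Suc k" by (cases l) auto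
      have tn: "real (t + n) - 1 > 0" using 2 assms by linarith
      have p: "?p = l / (2 * (real (t + n) - 1))"
        using 2 tn assms by (auto simp: pick_def min_def divide_simps)
      \<comment> \<open>Divided by \<open>2 * (real (t + n) - 1)\<close>, this says that
        \<open>r\<close> obeys the recursion of \<open>mean_count_Suc\<close>. The error is thus a
        convex combination of two earlier errors.\<close>
      have "real l * (r (t + n) k - r (t + n) l) = 2 * (real (t + n) - 1) * (r (t + Suc n) l - r (t + n) l)"
        unfolding r_def k by (simp add: divide_simps) algebra
      then have "r (t + Suc n) l = ?p * r (t + n) k + (1 - ?p) * r (t + n) l"
        unfolding p using tn by (simp add: divide_simps) argo
      then have "mean_count g t (Suc l) (Suc n) - r (t + Suc n) l
        = ?p * (mean_count g t (Suc k) n - r (t + n) k) + (1 - ?p) * (mean_count g t (Suc l) n - r (t + n) l)"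
        using k by (simp add: mean_count_Suc algebra_simps)
      also have "\<bar>\<dots>\<bar> \<le> \<bar>?p * (mean_count g t (Suc k) n - r (t + n) k)\<bar>
            + \<bar>(1 - ?p) * (mean_count g t (Suc l) n - r (t + n) l)\<bar>"
        by (rule abs_triangle_ineq)
      also have "\<dots> \<le> t"
        using Suc[of k] Suc[of l] pick_01[of "t + n" l] assms(1)
        by (auto simp: r_def abs_mult intro!: convex_bound_le)
      finally show ?thesis .
    next
      case 3
      have "mean_count g t (Suc l) (Suc n) = (\<Sum>v\<in>verts g. reach (Suc l) t (Suc n) (vdegree g v))"
        unfolding mean_count_def using 3 assms by (auto intro!: sum.neutral reach_eq_0)
      with init have "0 \<le> mean_count g t (Suc l) (Suc n)" "mean_count g t (Suc l) (Suc n) \<le> t" by metis+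
      moreover have "0 \<le> r (t + Suc n) l" using assms by (simp add: r_def)
      moreover have "r (t + Suc n) l \<le> 1"
      proof -
        have "2 * (t + n) \<le> l + 2" using 3 by presburger
        then have "2 * (real (t + Suc n) - 1) \<le> 1 * (real l + 2)" by simp
        also have "\<dots> \<le> (real l + 1) * (real l + 2)" by (intro mult_right_mono) auto
        finally show ?thesis by (simp add: r_def divide_simps)
      qed
      ultimately show ?thesis using assms by (simp add: abs_le_iff)
    qed
  qed
  then show ?thesis by (simp add: r_def)
qed

subsection \<open>One step of the process\<close>

context preferential_attachment begin

text \<open>Only the edge count is that of a tree; connectedness is not implied and loops may occur.
  The vertex set is deterministic: all randomness sits in the edges.\<close>

definition tree_like :: "nat \<Rightarrow> 'v graph \<Rightarrow> bool" where
  "tree_like t g \<longleftrightarrow> fin_graph g \<and> verts g = verts G0 \<union> new ` {\<tau>0<..t} \<and> Suc (size (edges g)) = t"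

lemma tree_like_finite: "tree_like t g \<Longrightarrow> finite (verts g)"
  unfolding tree_like_def fin_graph_def by blast

lemma tree_like_fresh:
  assumes "tree_like t g" "\<tau>0 \<le> t"
  shows "new (Suc t) \<notin> verts g"
proof
  assume "new (Suc t) \<in> verts g"
  then obtain s where "\<tau>0 < s" "s \<le> t" "new (Suc t) = new s"
    using new_fresh[of "Suc t"] assms by (auto simp: tree_like_def)
  then show False using inj_onD[OF new_inj, of "Suc t" s] by auto
qed

lemma tree_like_attach:
  assumes "tree_like t g" "\<tau>0 \<le> t" "v \<in> verts g"
  shows "tree_like (Suc t) (attach g (new (Suc t)) v)"
proof -
  have "{\<tau>0<..Suc t} = insert (Suc t) {\<tau>0<..t}" using assms by auto
  then show ?thesis using assms fin_graph_attach[of g v]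
    by (auto simp: tree_like_def) (auto simp: attach_def)
qed

section \<open>Histories and their transition probabilities\<close>

definition history :: "nat \<Rightarrow> 'w \<Rightarrow> nat \<Rightarrow> 'v graph" where
  "history t \<omega> = restrict (\<lambda>s. G s \<omega>) {\<tau>0..t}"

lemma graph_event: "\<tau>0 \<le> t \<Longrightarrow> {\<omega> \<in> space M. P (G t \<omega>)} \<in> events"
  using measurable_sets[OF random_graph, of t "{g. P g}"]
  by (simp add: vimage_def Int_def conj_commute)

text \<open>Outside \<open>{\<tau>0..t}\<close> both functions are \<open>undefined\<close>, so
  equality is a condition on finitely many graphs and matches the conditioning event of
  \<open>step\<close>.\<close>

lemma history_eq_iff:
  "h \<in> extensional {\<tau>0..t} \<Longrightarrow> history t \<omega> = h \<longleftrightarrow> (\<forall>s\<in>{\<tau>0..t}. G s \<omega> = h s)"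
  by (auto simp: history_def fun_eq_iff extensional_def restrict_def)

lemma history_event:
  assumes "h \<in> extensional {\<tau>0..t}"
  shows "{\<omega> \<in> space M. history t \<omega> = h} \<in> events"
  unfolding history_eq_iff[OF assms]
  by (intro sets.sets_Collect_finite_All) (auto intro!: graph_event)

lemma history_attach_event:
  assumes "h \<in> extensional {\<tau>0..t}" "\<tau>0 \<le> t"
  shows "{\<omega> \<in> space M. history t \<omega> = h \<and> G (Suc t) \<omega> = g} \<in> events"
  using assms by (intro sets.sets_Collect_conj history_event graph_event) auto

text \<open>In this product form the transition rule also covers histories of probability 0, to
  which \<open>step\<close> does not apply.\<close>

lemma prob_attach:
  assumes h: "h \<in> extensional {\<tau>0..t}" and t: "\<tau>0 \<le> t" and g: "tree_like t (h t)"
    and v: "v \<in> verts (h t)"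
  shows "prob {\<omega> \<in> space M. history t \<omega> = h \<and> G (Suc t) \<omega> = attach (h t) (new (Suc t)) v}
    = prob {\<omega> \<in> space M. history t \<omega> = h} * (vdegree (h t) v / (2 * (real t - 1)))"
    (is "prob ?B = prob ?A * _")
proof (cases "prob ?A > 0")
  case True
  have A: "?A = {\<omega> \<in> space M. \<forall>s\<in>{\<tau>0..<Suc t}. G s \<omega> = h s}"
    unfolding history_eq_iff[OF h] by auto
  have B: "?B = {\<omega> \<in> space M. G (Suc t) \<omega> = attach (h t) (new (Suc t)) v \<and> (\<forall>s\<in>{\<tau>0..<Suc t}. G s \<omega> = h s)}"
    unfolding history_eq_iff[OF h] by auto
  have "fin_graph (h t)" "Suc (size (edges (h t))) = t" using g by (auto simp: tree_like_def)
  then have "real (\<Sum>u\<in>verts (h t). vdegree (h t) u) = 2 * (real t - 1)"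
    by (auto simp: vdegree_sum)
  then show ?thesis
    using step[of "Suc t" v h] t v True unfolding cond_prob_def A B
    by (auto simp: divide_simps split: if_splits)
next
  case False
  then have "prob ?A = 0" by (simp add: zero_less_measure_iff)
  moreover have "prob ?B \<le> prob ?A" using history_event[OF h] by (intro finite_measure_mono) auto
  ultimately show ?thesis by (simp add: measure_le_0_iff)
qed

lemma sum_attach_prob:
  assumes "tree_like t g" "2 \<le> t"
  shows "(\<Sum>v\<in>verts g. vdegree g v / (2 * (real t - 1))) = 1"
proof -
  have "fin_graph g" "Suc (size (edges g)) = t" using assms by (auto simp: tree_like_def)
  then have "real (\<Sum>v\<in>verts g. vdegree g v) = 2 * (real t - 1)" by (auto simp: vdegree_sum)
  then show ?thesis using assms by (simp flip: sum_divide_distrib)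
qed

text \<open>\<open>step\<close> only gives the probability of each attachment. These probabilities
  sum to 1 given the history, so the disjoint attachment events exhaust it up to a null set.\<close>

lemma AE_attach:
  assumes h: "h \<in> extensional {\<tau>0..t}" and t: "\<tau>0 \<le> t" "2 \<le> t" and g: "tree_like t (h t)"
  shows "AE \<omega> in M. history t \<omega> = h \<longrightarrow> (\<exists>v\<in>verts (h t). G (Suc t) \<omega> = attach (h t) (new (Suc t)) v)"
proof -
  let ?A = "{\<omega> \<in> space M. history t \<omega> = h}"
  let ?B = "\<lambda>v. {\<omega> \<in> space M. history t \<omega> = h \<and> G (Suc t) \<omega> = attach (h t) (new (Suc t)) v}"
  have fin: "finite (verts (h t))" using g by (rule tree_like_finite)
  have ev: "?A \<in> events" "?B v \<in> events" for v
    using history_event[OF h] history_attach_event[OF h t(1)] by auto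
  have "prob (\<Union>v\<in>verts (h t). ?B v) = (\<Sum>v\<in>verts (h t). prob (?B v))"
    using fin ev by (intro finite_measure_finite_Union) (auto simp: disjoint_family_on_def attach_inj)
  also have "\<dots> = (\<Sum>v\<in>verts (h t). prob ?A * (vdegree (h t) v / (2 * (real t - 1))))"
    by (intro sum.cong refl prob_attach h t(1) g)
  also have "\<dots> = prob ?A"
    by (simp only: sum_distrib_left[symmetric] sum_attach_prob[OF g t(2)] mult_1_right)
  finally have "prob (?A - (\<Union>v\<in>verts (h t). ?B v)) = 0"
    using fin ev by (subst finite_measure_Diff) auto
  then have "AE \<omega> in M. \<omega> \<notin> ?A - (\<Union>v\<in>verts (h t). ?B v)"
    using fin ev by (intro AE_not_in) (auto simp: null_sets_def emeasure_eq_measure)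
  then show ?thesis using AE_space by eventually_elim auto
qed

text \<open>Each history has almost surely one continuation per existing vertex, so finitely many
  carry all the mass. This turns expectations into finite sums and makes every real function of the
  graph integrable.\<close>

lemma finite_histories:
  assumes "2 \<le> \<tau>0" "fin_graph G0" "Suc (size (edges G0)) = \<tau>0" "\<tau>0 \<le> t"
  shows "\<exists>H. finite H \<and> (\<forall>h\<in>H. h \<in> extensional {\<tau>0..t} \<and> tree_like t (h t)) \<and> (AE \<omega> in M. history t \<omega> \<in> H)"
  using assms(4)
proof (induction t rule: dec_induct)
  case base
  have "AE \<omega> in M. history \<tau>0 \<omega> \<in> {restrict (\<lambda>_. G0) {\<tau>0..\<tau>0}}"
    using initial by eventually_elim (auto simp: history_def fun_eq_iff restrict_def)
  moreover have "tree_like \<tau>0 (restrict (\<lambda>_. G0) {\<tau>0..\<tau>0} \<tau>0)" using assms by (simp add: tree_like_def)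
  ultimately show ?case
    by (intro exI[of _ "{restrict (\<lambda>_. G0) {\<tau>0..\<tau>0}}"]) (blast intro: restrict_extensional)
next
  case (step t)
  then obtain H where H: "finite H" "\<And>h. h \<in> H \<Longrightarrow> h \<in> extensional {\<tau>0..t}"
      "\<And>h. h \<in> H \<Longrightarrow> tree_like t (h t)" and ae: "AE \<omega> in M. history t \<omega> \<in> H"
    by blast
  define H' where "H' = (\<Union>h\<in>H. (\<lambda>v. h(Suc t := attach (h t) (new (Suc t)) v)) ` verts (h t))"
  have "finite H'" using H(1,3) by (auto simp: H'_def intro: tree_like_finite)
  moreover have "h \<in> extensional {\<tau>0..Suc t} \<and> tree_like (Suc t) (h (Suc t))" if "h \<in> H'" for h
    using that H(2,3) tree_like_attach[OF _ \<open>\<tau>0 \<le> t\<close>] step.hyps by (auto simp: H'_def extensional_def)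
  moreover have "AE \<omega> in M. \<forall>h\<in>H. history t \<omega> = h \<longrightarrow> (\<exists>v\<in>verts (h t). G (Suc t) \<omega> = attach (h t) (new (Suc t)) v)"
    using H step.hyps assms(1) by (intro AE_finite_allI AE_attach) auto
  with ae have "AE \<omega> in M. history (Suc t) \<omega> \<in> H'"
  proof eventually_elim
    case (elim \<omega>)
    then obtain v where v: "v \<in> verts (history t \<omega> t)" "G (Suc t) \<omega> = attach (history t \<omega> t) (new (Suc t)) v"
      by blast
    have "history (Suc t) \<omega> = (history t \<omega>)(Suc t := G (Suc t) \<omega>)"
      using step.hyps by (auto simp: history_def restrict_def fun_eq_iff)
    then show ?case using v elim(1) unfolding H'_def by force
  qed
  ultimately show ?case by blast
qed

lemma graph_AE:
  assumes "2 \<le> \<tau>0" "fin_graph G0" "Suc (size (edges G0)) = \<tau>0" "\<tau>0 \<le> t"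
  shows "\<exists>S. finite S \<and> (\<forall>g\<in>S. tree_like t g) \<and> (AE \<omega> in M. G t \<omega> \<in> S)"
proof -
  obtain H where H: "finite H" "\<And>h. h \<in> H \<Longrightarrow> tree_like t (h t)" "AE \<omega> in M. history t \<omega> \<in> H"
    using finite_histories[OF assms] by blast
  have "AE \<omega> in M. G t \<omega> \<in> (\<lambda>h. h t) ` H"
    using H(3)
  proof eventually_elim
    case (elim \<omega>)
    have "G t \<omega> = history t \<omega> t" using assms(4) by (simp add: history_def)
    then show ?case using elim by auto
  qed
  then show ?thesis using H by (intro exI[of _ "(\<lambda>h. h t) ` H"]) auto
qed

lemma integrable_graph:
  fixes f :: "'v graph \<Rightarrow> real"
  assumes "2 \<le> \<tau>0" "fin_graph G0" "Suc (size (edges G0)) = \<tau>0" "\<tau>0 \<le> t"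
  shows "integrable M (\<lambda>\<omega>. f (G t \<omega>))"
proof -
  obtain S where S: "finite S" "AE \<omega> in M. G t \<omega> \<in> S"
    using graph_AE[OF assms] by blast
  have "(\<lambda>\<omega>. f (G t \<omega>)) \<in> borel_measurable M"
    by (rule measurable_compose[OF random_graph[OF assms(4)]]) simp
  moreover have "AE \<omega> in M. norm (f (G t \<omega>)) \<le> (\<Sum>g\<in>S. \<bar>f g\<bar>)"
    using S(2) by eventually_elim (use S(1) in \<open>auto intro: member_le_sum[of _ S "\<lambda>g. \<bar>f g\<bar>"]\<close>)
  ultimately show ?thesis by (intro integrable_const_bound) auto
qed

text \<open>The Markov property in integrated form: split by history and chosen vertex, apply
  \<open>prob_attach\<close> to each piece, and reassemble the histories into a function of the
  current graph.\<close>

lemma expectation_step: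
  fixes f :: "'v graph \<Rightarrow> real"
  assumes "2 \<le> \<tau>0" "fin_graph G0" "Suc (size (edges G0)) = \<tau>0" "\<tau>0 \<le> t"
  shows "expectation (\<lambda>\<omega>. f (G (Suc t) \<omega>)) = expectation (\<lambda>\<omega>.
    \<Sum>v\<in>verts (G t \<omega>). vdegree (G t \<omega>) v / (2 * (real t - 1)) * f (attach (G t \<omega>) (new (Suc t)) v))"
    (is "_ = expectation (\<lambda>\<omega>. ?K (G t \<omega>))")
proof -
  obtain H where H: "finite H" "\<And>h. h \<in> H \<Longrightarrow> h \<in> extensional {\<tau>0..t}"
      "\<And>h. h \<in> H \<Longrightarrow> tree_like t (h t)" and ae: "AE \<omega> in M. history t \<omega> \<in> H"
    using finite_histories[OF assms] by blast
  have fin: "finite (verts (h t))" if "h \<in> H" for h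
    using H(3)[OF that] by (rule tree_like_finite)
  define A where "A h = {\<omega> \<in> space M. history t \<omega> = h}" for h
  define B where "B h v = {\<omega> \<in> space M. history t \<omega> = h \<and> G (Suc t) \<omega> = attach (h t) (new (Suc t)) v}" for h v
  have ev: "A h \<in> events" "B h v \<in> events" if "h \<in> H" for h v
    using history_event[OF H(2)[OF that]] history_attach_event[OF H(2)[OF that] assms(4)]
    by (auto simp: A_def B_def)
  have "AE \<omega> in M. \<forall>h\<in>H. history t \<omega> = h \<longrightarrow> (\<exists>v\<in>verts (h t). G (Suc t) \<omega> = attach (h t) (new (Suc t)) v)"
    using H assms by (intro AE_finite_allI AE_attach) auto
  with ae AE_space have "AE \<omega> in M. f (G (Suc t) \<omega>) =
    (\<Sum>h\<in>H. \<Sum>v\<in>verts (h t). f (attach (h t) (new (Suc t)) v) * indicator (B h v) \<omega>)"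
  proof eventually_elim
    case (elim \<omega>)
    define h where "h = history t \<omega>"
    obtain v where v: "v \<in> verts (h t)" "G (Suc t) \<omega> = attach (h t) (new (Suc t)) v"
      using elim by (auto simp: h_def)
    \<comment> \<open>Distinct vertices give distinct graphs (\<open>attach_inj\<close>), so exactly
      one indicator is 1.\<close>
    have "(\<Sum>h'\<in>H. \<Sum>v'\<in>verts (h' t). f (attach (h' t) (new (Suc t)) v') * indicator (B h' v') \<omega>)
      = (\<Sum>h'\<in>H. if h' = h then (\<Sum>v'\<in>verts (h t). if v' = v then f (attach (h t) (new (Suc t)) v) else 0) else 0)"
      using elim(2) v(2)
      by (intro sum.cong refl) (auto simp: B_def h_def[symmetric] attach_inj indicator_def intro!: sum.cong sum.neutral)
    also have "\<dots> = f (attach (h t) (new (Suc t)) v)"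
      using H(1) fin v(1) elim(1) by (simp add: h_def[symmetric])
    finally show ?case using v by simp
  qed
  then have "expectation (\<lambda>\<omega>. f (G (Suc t) \<omega>)) = expectation (\<lambda>\<omega>.
      \<Sum>h\<in>H. \<Sum>v\<in>verts (h t). f (attach (h t) (new (Suc t)) v) * indicator (B h v) \<omega>)"
  proof (rule integral_cong_AE[rotated -1])
    show "(\<lambda>\<omega>. f (G (Suc t) \<omega>)) \<in> borel_measurable M"
      by (rule measurable_compose[OF random_graph]) (use assms(4) in auto)
  qed (intro borel_measurable_sum borel_measurable_times borel_measurable_const
      borel_measurable_indicator ev)
  also have "\<dots> = (\<Sum>h\<in>H. \<Sum>v\<in>verts (h t). f (attach (h t) (new (Suc t)) v) * prob (B h v))"
  proof -
    have int: "integrable M (\<lambda>\<omega>. c * indicator (B h v) \<omega> :: real)" if "h \<in> H" for c h v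
      using ev(2)[OF that] by (intro integrable_mult_right integrable_real_indicator) (auto simp: emeasure_eq_measure)
    show ?thesis
    proof (subst Bochner_Integration.integral_sum)
      show "integrable M (\<lambda>\<omega>. \<Sum>v\<in>verts (h t). f (attach (h t) (new (Suc t)) v) * indicator (B h v) \<omega>)"
        if "h \<in> H" for h using int[OF that] by (intro Bochner_Integration.integrable_sum)
      show "(\<Sum>h\<in>H. expectation (\<lambda>\<omega>. \<Sum>v\<in>verts (h t). f (attach (h t) (new (Suc t)) v) * indicator (B h v) \<omega>))
        = (\<Sum>h\<in>H. \<Sum>v\<in>verts (h t). f (attach (h t) (new (Suc t)) v) * prob (B h v))"
        using int ev by (intro sum.cong refl, subst Bochner_Integration.integral_sum) auto
    qed
  qed
  also have "\<dots> = (\<Sum>h\<in>H. ?K (h t) * prob (A h))"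
  proof (rule sum.cong)
    fix h assume h: "h \<in> H"
    have "prob (B h v) = prob (A h) * (vdegree (h t) v / (2 * (real t - 1)))" if "v \<in> verts (h t)" for v
      unfolding A_def B_def by (rule prob_attach[OF H(2)[OF h] assms(4) H(3)[OF h] that])
    then show "(\<Sum>v\<in>verts (h t). f (attach (h t) (new (Suc t)) v) * prob (B h v)) = ?K (h t) * prob (A h)"
      unfolding sum_distrib_right by (intro sum.cong refl) (simp add: mult_ac)
  qed simp
  also have "\<dots> = expectation (\<lambda>\<omega>. \<Sum>h\<in>H. ?K (h t) * indicator (A h) \<omega>)"
  proof (subst Bochner_Integration.integral_sum)
    show "integrable M (\<lambda>\<omega>. ?K (h t) * indicator (A h) \<omega>)" if "h \<in> H" for h
      using ev(1)[OF that] by (intro integrable_mult_right integrable_real_indicator) (auto simp: emeasure_eq_measure)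
    show "(\<Sum>h\<in>H. ?K (h t) * prob (A h)) = (\<Sum>h\<in>H. expectation (\<lambda>\<omega>. ?K (h t) * indicator (A h) \<omega>))"
      using ev by (intro sum.cong refl) simp
  qed
  also have "\<dots> = expectation (\<lambda>\<omega>. ?K (G t \<omega>))"
  proof (rule integral_cong_AE)
    show "AE \<omega> in M. (\<Sum>h\<in>H. ?K (h t) * indicator (A h) \<omega>) = ?K (G t \<omega>)"
      using ae AE_space
    proof eventually_elim
      case (elim \<omega>)
      have "(\<Sum>h\<in>H. ?K (h t) * indicator (A h) \<omega>) = (\<Sum>h\<in>H. if h = history t \<omega> then ?K (h t) else 0)"
        using elim(2) by (intro sum.cong refl) (auto simp: A_def)
      also have "\<dots> = ?K (history t \<omega> t)" using H(1) elim(1) by simp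
      finally show ?case using assms(4) by (simp add: history_def)
    qed
    show "(\<lambda>\<omega>. ?K (G t \<omega>)) \<in> borel_measurable M"
      by (rule measurable_compose[OF random_graph[OF assms(4)]]) simp
  qed (use ev in auto)
  finally show ?thesis .
qed

subsection \<open>Concentration\<close>

text \<open>For \<open>n = 0\<close> and \<open>c = exp \<theta> - 1\<close> this is
  \<open>exp (\<theta> * num_deg_ge g l)\<close>. For \<open>n > 0\<close> it is the conditional
  expectation that independent vertices would give, restricted to those already present.\<close>

definition tilt :: "real \<Rightarrow> nat \<Rightarrow> nat \<Rightarrow> nat \<Rightarrow> 'v graph \<Rightarrow> real" where
  "tilt c l t n g = (\<Prod>v\<in>verts g. 1 + c * reach l t n (vdegree g v))"

lemma tilt_factor_pos:
  assumes "-1 < c" "1 \<le> t"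
  shows "0 < 1 + c * reach l t n d"
proof -
  have r: "0 \<le> reach l t n d" "reach l t n d \<le> 1" using reach_01[OF assms(2)] by auto
  show ?thesis
  proof (cases "0 \<le> c")
    case False
    then have "c * 1 \<le> c * reach l t n d" using r by (intro mult_left_mono_neg) auto
    then show ?thesis using assms by linarith
  qed (use r in \<open>simp add: add_pos_nonneg\<close>)
qed

lemma tilt_step:
  assumes "-1 < c" "2 \<le> t" "\<tau>0 \<le> t" "tree_like t g"
  shows "(\<Sum>v\<in>verts g. vdegree g v / (2 * (real t - 1)) * tilt c l (Suc t) n (attach g (new (Suc t)) v))
    \<le> (1 + c * reach l (Suc t) n 1) * tilt c l t (Suc n) g"
proof -
  define F where "F d = 1 + c * reach l (Suc t) n d" for d
  define p where "p v = vdegree g v / (2 * (real t - 1))" for v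
  \<comment> \<open>\<open>y v\<close> is the expected relative change of the factor of
    \<open>v\<close> in this step, so \<open>F (vdegree g v) * (1 + y v)\<close> is the factor with
    one more step to go. Since exactly one old vertex changes, the expected relative change of the
    whole product is the sum of the \<open>y v\<close>.\<close>
  define y where "y v = p v * (F (Suc (vdegree g v)) / F (vdegree g v) - 1)" for v
  have fin: "finite (verts g)" and fg: "fin_graph g" using assms(4) tree_like_finite by (auto simp: tree_like_def)
  have new: "new (Suc t) \<notin> verts g" using tree_like_fresh assms by blast
  have pos: "0 < F d" for d unfolding F_def using assms by (intro tilt_factor_pos) auto
  have p1: "(\<Sum>v\<in>verts g. p v) = 1"
    unfolding p_def using assms by (intro sum_attach_prob) auto
  have p01: "0 \<le> p v" "p v \<le> 1" if "v \<in> verts g" for v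
    using vdegree_le[OF fg that] assms(2,4) by (auto simp: p_def tree_like_def divide_simps)
  have attach: "tilt c l (Suc t) n (attach g (new (Suc t)) v)
      = F 1 * ((\<Prod>u\<in>verts g. F (vdegree g u)) * (F (Suc (vdegree g v)) / F (vdegree g v)))"
    if v: "v \<in> verts g" for v
  proof -
    have "tilt c l (Suc t) n (attach g (new (Suc t)) v)
        = (\<Prod>u\<in>insert (new (Suc t)) (verts g). F (vdegree (attach g (new (Suc t)) v) u))"
      by (simp add: tilt_def F_def attach_def)
    also have "\<dots> = F 1 * (\<Prod>u\<in>verts g. F (vdegree g u + of_bool (u = v)))"
      using fin new v fg by (simp add: vdegree_attach_new vdegree_attach_old cong: prod.cong)
    also have "(\<Prod>u\<in>verts g. F (vdegree g u + of_bool (u = v)))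
        = F (Suc (vdegree g v)) * (\<Prod>u\<in>verts g - {v}. F (vdegree g u))"
      using fin v by (subst prod.remove[of _ v]) (auto intro!: prod.cong)
    also have "\<dots> = (\<Prod>u\<in>verts g. F (vdegree g u)) * (F (Suc (vdegree g v)) / F (vdegree g v))"
      using fin v pos[of "vdegree g v"] by (subst (2) prod.remove[of _ v]) (auto simp: field_simps)
    finally show ?thesis .
  qed
  have "(\<Sum>v\<in>verts g. p v * tilt c l (Suc t) n (attach g (new (Suc t)) v))
      = F 1 * (\<Prod>u\<in>verts g. F (vdegree g u)) * (\<Sum>v\<in>verts g. p v + y v)"
    unfolding sum_distrib_left by (intro sum.cong refl) (simp add: attach y_def algebra_simps)
  also have "(\<Sum>v\<in>verts g. p v + y v) = 1 + (\<Sum>v\<in>verts g. y v)"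
    by (simp add: sum.distrib p1)
  also have "\<dots> \<le> (\<Prod>v\<in>verts g. 1 + y v)"
  proof (rule one_plus_sum_le_prod[OF fin])
    have ratio: "F (Suc d) / F d - 1 = c * (reach l (Suc t) n (Suc d) - reach l (Suc t) n d) / F d" for d
      using pos[of d] by (simp add: F_def field_simps)
    have mono: "0 \<le> reach l (Suc t) n (Suc d) - reach l (Suc t) n d" for d
      using reach_mono_Suc[of "Suc t"] by simp
    have ge: "-1 \<le> F (Suc d) / F d - 1" for d using pos[of d] pos[of "Suc d"] by simp
    \<comment> \<open>By monotonicity of \<open>reach\<close> every \<open>y v\<close> has the sign
      of \<open>c\<close>. For negative \<open>c\<close> the bound -1 comes from positivity of the
      factors and \<open>p v \<le> 1\<close>.\<close>
    show "(\<forall>v\<in>verts g. 0 \<le> y v) \<or> (\<forall>v\<in>verts g. - 1 \<le> y v \<and> y v \<le> 0)"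
    proof (cases "0 \<le> c")
      case True
      then have "0 \<le> F (Suc d) / F d - 1" for d
        unfolding ratio using mono[of d] pos[of d] by simp
      then show ?thesis using p01 by (auto simp: y_def)
    next
      case False
      then have le: "F (Suc d) / F d - 1 \<le> 0" for d
        unfolding ratio using mono[of d] pos[of d]
        by (intro divide_nonpos_pos mult_nonpos_nonneg) auto
      have "-1 \<le> y v \<and> y v \<le> 0" if "v \<in> verts g" for v
      proof
        have "-1 \<le> F (Suc (vdegree g v)) / F (vdegree g v) - 1" by (rule ge)
        also have "\<dots> \<le> y v"
          unfolding y_def using p01[OF that] le[of "vdegree g v"]
            mult_right_mono_neg[of "p v" 1 "F (Suc (vdegree g v)) / F (vdegree g v) - 1"] by simp
        finally show "-1 \<le> y v" .
        show "y v \<le> 0" unfolding y_def using p01[OF that] le by (intro mult_nonneg_nonpos) auto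
      qed
      then show ?thesis by blast
    qed
  qed
  also have "F 1 * (\<Prod>u\<in>verts g. F (vdegree g u)) * (\<Prod>v\<in>verts g. 1 + y v)
      = F 1 * (\<Prod>v\<in>verts g. F (vdegree g v) * (1 + y v))"
    by (simp add: prod.distrib)
  also have "(\<Prod>v\<in>verts g. F (vdegree g v) * (1 + y v)) = tilt c l t (Suc n) g"
    unfolding tilt_def
  proof (rule prod.cong)
    fix v assume v: "v \<in> verts g"
    have "pick t (vdegree g v) = p v" using p01[OF v] by (simp add: pick_def p_def)
    then show "F (vdegree g v) * (1 + y v) = 1 + c * reach l t (Suc n) (vdegree g v)"
      using pos[of "vdegree g v"] by (simp add: y_def field_simps) (simp add: F_def algebra_simps)
  qed simp
  finally show ?thesis
    using pos prod_pos[of "verts g" "\<lambda>u. F (vdegree g u)"] by (simp add: p_def F_def)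
qed

text \<open>\<open>n\<close> counts elapsed steps and \<open>m\<close> the steps left. Each use of
  \<open>tilt_step\<close> moves one step from \<open>n\<close> to \<open>m\<close> and releases the
  factor of the vertex just born, so \<open>m\<close> must vary in the induction.\<close>

lemma expectation_tilt:
  assumes "2 \<le> \<tau>0" "fin_graph G0" "Suc (size (edges G0)) = \<tau>0" "-1 < c"
  shows "expectation (\<lambda>\<omega>. tilt c l (\<tau>0 + n) m (G (\<tau>0 + n) \<omega>))
    \<le> tilt c l \<tau>0 (n + m) G0 * (\<Prod>i<n. 1 + c * reach l (\<tau>0 + Suc i) (n + m - Suc i) 1)"
proof (induction n arbitrary: m)
  case 0
  have "expectation (\<lambda>\<omega>. tilt c l \<tau>0 m (G \<tau>0 \<omega>)) = expectation (\<lambda>\<omega>. tilt c l \<tau>0 m G0)"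
    using initial by (intro integral_cong_AE)
      (auto elim!: eventually_mono intro!: measurable_compose[OF random_graph])
  then show ?case by (simp add: prob_space)
next
  case (Suc n)
  let ?t = "\<tau>0 + n" and ?F = "1 + c * reach l (Suc (\<tau>0 + n)) m 1"
  let ?K = "\<lambda>g. \<Sum>v\<in>verts g. vdegree g v / (2 * (real ?t - 1)) * tilt c l (Suc ?t) m (attach g (new (Suc ?t)) v)"
  obtain S where S: "\<forall>g\<in>S. tree_like ?t g" "AE \<omega> in M. G ?t \<omega> \<in> S"
    using graph_AE[OF assms(1-3), of ?t] by auto
  have "expectation (\<lambda>\<omega>. tilt c l (Suc ?t) m (G (Suc ?t) \<omega>)) = expectation (\<lambda>\<omega>. ?K (G ?t \<omega>))"
    by (rule expectation_step[OF assms(1-3)]) simp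
  also have "\<dots> \<le> expectation (\<lambda>\<omega>. ?F * tilt c l ?t (Suc m) (G ?t \<omega>))"
  proof (rule integral_mono_AE)
    show "AE \<omega> in M. ?K (G ?t \<omega>) \<le> ?F * tilt c l ?t (Suc m) (G ?t \<omega>)"
      using S(2)
    proof eventually_elim
      case (elim \<omega>)
      show ?case by (rule tilt_step) (use elim S(1) assms(1,4) in auto)
    qed
  qed (rule integrable_graph[OF assms(1-3)], simp)+
  also have "\<dots> = ?F * expectation (\<lambda>\<omega>. tilt c l ?t (Suc m) (G ?t \<omega>))" by simp
  also have "\<dots> \<le> ?F * (tilt c l \<tau>0 (n + Suc m) G0 * (\<Prod>i<n. 1 + c * reach l (\<tau>0 + Suc i) (n + Suc m - Suc i) 1))"
    using assms(4) by (intro mult_left_mono Suc.IH less_imp_le[OF tilt_factor_pos]) auto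
  finally show ?case by (simp add: mult_ac)
qed

section \<open>Exponential moments and tail bounds\<close>

lemma mgf_num_deg_ge:
  fixes \<theta> :: real
  assumes "2 \<le> \<tau>0" "fin_graph G0" "Suc (size (edges G0)) = \<tau>0"
  shows "expectation (\<lambda>\<omega>. exp (\<theta> * num_deg_ge (G (\<tau>0 + n) \<omega>) l))
    \<le> exp ((exp \<theta> - 1) * mean_count G0 \<tau>0 l n)"
proof -
  define c where "c = exp \<theta> - 1"
  have c: "-1 < c" by (simp add: c_def)
  obtain S where S: "\<forall>g\<in>S. tree_like (\<tau>0 + n) g" "AE \<omega> in M. G (\<tau>0 + n) \<omega> \<in> S"
    using graph_AE[OF assms, of "\<tau>0 + n"] by auto
  have tilt: "exp (\<theta> * num_deg_ge g l) = tilt c l t 0 g" if "finite (verts g)" for g t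
  proof -
    have "tilt c l t 0 g = (\<Prod>v\<in>verts g. if l \<le> vdegree g v then exp \<theta> else 1)"
      unfolding tilt_def by (intro prod.cong) (auto simp: c_def)
    also have "\<dots> = exp \<theta> ^ num_deg_ge g l"
      using that by (simp add: prod.If_cases num_deg_ge_def Int_def)
    finally show ?thesis by (simp add: exp_of_nat_mult[symmetric] mult.commute)
  qed
  have "expectation (\<lambda>\<omega>. exp (\<theta> * num_deg_ge (G (\<tau>0 + n) \<omega>) l))
      = expectation (\<lambda>\<omega>. tilt c l (\<tau>0 + n) 0 (G (\<tau>0 + n) \<omega>))"
  proof (rule integral_cong_AE)
    show "AE \<omega> in M. exp (\<theta> * num_deg_ge (G (\<tau>0 + n) \<omega>) l) = tilt c l (\<tau>0 + n) 0 (G (\<tau>0 + n) \<omega>)"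
      using S(2) by eventually_elim (use S(1) in \<open>auto intro!: tilt tree_like_finite\<close>)
  qed (rule measurable_compose[OF random_graph], simp_all)+
  also have "\<dots> \<le> tilt c l \<tau>0 n G0 * (\<Prod>i<n. 1 + c * reach l (\<tau>0 + Suc i) (n - Suc i) 1)"
    using expectation_tilt[OF assms c, of l n 0] by simp
  \<comment> \<open>\<open>1 + x \<le> exp x\<close> in every factor; the result is the moment
    generating function of a Poisson variable with mean
    \<open>mean_count G0 \<tau>0 l n\<close>.\<close>
  also have "\<dots> \<le> exp (\<Sum>v\<in>verts G0. c * reach l \<tau>0 n (vdegree G0 v))
      * exp (\<Sum>i<n. c * reach l (\<tau>0 + Suc i) (n - Suc i) 1)"
    using assms(1,2) unfolding tilt_def
    by (intro mult_mono prod_nonneg) (auto simp: exp_sum fin_graph_def intro!: prod_mono prod_nonneg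
        less_imp_le[OF tilt_factor_pos[OF c]])
  also have "\<dots> = exp (c * mean_count G0 \<tau>0 l n)"
    by (simp add: mean_count_def sum_distrib_left distrib_left exp_add)
  finally show ?thesis by (simp add: c_def)
qed

text \<open>A two-sided Chernoff bound with \<open>s = \<plusminus>sqrt (K / \<nu>)\<close>. From
  \<open>K \<le> \<nu>\<close> follows \<open>\<bar>s\<bar> \<le> 1\<close>, hence
  \<open>exp s - 1 \<le> s + s\<^sup>2\<close>, and the exponent is at most
  \<open>s\<^sup>2 * \<mu> - 2 * K \<le> - K\<close>.\<close>

lemma num_deg_ge_deviation:
  fixes K \<nu> :: real
  assumes "2 \<le> \<tau>0" "fin_graph G0" "Suc (size (edges G0)) = \<tau>0"
    and "mean_count G0 \<tau>0 l n \<le> \<nu>" "0 < K" "K \<le> \<nu>"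
  shows "prob {\<omega> \<in> space M. 2 * sqrt (K * \<nu>) \<le> \<bar>real (num_deg_ge (G (\<tau>0 + n) \<omega>) l) - mean_count G0 \<tau>0 l n\<bar>}
    \<le> 2 * exp (- K)"
proof -
  define \<mu> where "\<mu> = mean_count G0 \<tau>0 l n"
  define U where "U \<omega> = real (num_deg_ge (G (\<tau>0 + n) \<omega>) l)" for \<omega>
  define \<theta> where "\<theta> = sqrt (K / \<nu>)"
  have \<theta>: "0 < \<theta>" "\<theta> \<le> 1" using assms(5,6) by (auto simp: \<theta>_def)
  have mu0: "0 \<le> \<mu>" unfolding \<mu>_def mean_count_def using assms(1) reach_01
    by (intro add_nonneg_nonneg sum_nonneg) auto
  have "\<theta>\<^sup>2 * \<nu> = K" using assms(5,6) by (simp add: \<theta>_def)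
  moreover have "\<theta>\<^sup>2 * \<mu> \<le> \<theta>\<^sup>2 * \<nu>" using assms(4) by (intro mult_left_mono) (auto simp: \<mu>_def)
  ultimately have A: "\<theta>\<^sup>2 * \<mu> \<le> K" by simp
  have B: "\<theta> * (2 * sqrt (K * \<nu>)) = 2 * K"
    using assms(5,6) by (simp add: \<theta>_def real_sqrt_mult real_sqrt_divide)
  have tail: "prob {\<omega> \<in> space M. 2 * sqrt (K * \<nu>) * \<theta> \<le> s * (U \<omega> - \<mu>)} \<le> exp (- K)"
    if s: "s = \<theta> \<or> s = - \<theta>" for s
  proof -
    have e: "exp s - 1 \<le> s + s\<^sup>2"
    proof (cases "s = \<theta>")
      case True
      then show ?thesis using exp_bound[of \<theta>] \<theta> by simp
    next
      case False
      then have s: "s = - \<theta>" using s by simp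
      have "1 + \<theta> \<le> exp \<theta>" by simp
      then have "exp (- \<theta>) * (1 + \<theta>) \<le> exp (-\<theta>) * exp \<theta>" by (intro mult_left_mono) auto
      also have "\<dots> = 1" by (simp flip: exp_add)
      \<comment> \<open>The product equals \<open>1 + \<theta> ^ 3\<close>.\<close>
      also have "1 \<le> (1 - \<theta> + \<theta>\<^sup>2) * (1 + \<theta>)"
        using \<theta> by (simp add: algebra_simps power2_eq_square)
      finally have "exp (- \<theta>) \<le> 1 - \<theta> + \<theta>\<^sup>2" using \<theta> by simp
      then show ?thesis by (simp add: s)
    qed
    have int: "integrable M (\<lambda>\<omega>. exp (s * U \<omega>))"
      unfolding U_def by (rule integrable_graph[OF assms(1-3)]) simp
    have "prob {\<omega> \<in> space M. 2 * sqrt (K * \<nu>) * \<theta> \<le> s * (U \<omega> - \<mu>)}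
        = prob {\<omega> \<in> space M. exp (s * \<mu> + 2 * K) \<le> exp (s * U \<omega>)}"
      unfolding B mult.commute[of _ \<theta>] by (simp add: right_diff_distrib le_diff_eq add.commute)
    also have "\<dots> \<le> expectation (\<lambda>\<omega>. exp (s * U \<omega>)) / exp (s * \<mu> + 2 * K)"
      by (intro integral_Markov_inequality_measure[OF int, of "{}"]) auto
    also have "\<dots> \<le> exp ((exp s - 1) * \<mu>) / exp (s * \<mu> + 2 * K)"
      using mgf_num_deg_ge[OF assms(1-3), of s n l] unfolding U_def \<mu>_def by (intro divide_right_mono) auto
    also have "\<dots> = exp ((exp s - 1) * \<mu> - s * \<mu> - 2 * K)" by (simp add: exp_diff[symmetric] algebra_simps)
    also have "\<dots> \<le> exp (- K)"
    proof -
      have "(exp s - 1) * \<mu> \<le> (s + s\<^sup>2) * \<mu>" using e mu0 by (rule mult_right_mono)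
      moreover have "s\<^sup>2 = \<theta>\<^sup>2" using s by auto
      ultimately show ?thesis using A by (simp add: algebra_simps)
    qed
    finally show ?thesis .
  qed
  have ev: "{\<omega> \<in> space M. P (U \<omega>)} \<in> events" for P
    unfolding U_def by (rule graph_event) simp
  have "{\<omega> \<in> space M. 2 * sqrt (K * \<nu>) \<le> \<bar>U \<omega> - \<mu>\<bar>}
      \<subseteq> {\<omega> \<in> space M. 2 * sqrt (K * \<nu>) * \<theta> \<le> \<theta> * (U \<omega> - \<mu>)}
        \<union> {\<omega> \<in> space M. 2 * sqrt (K * \<nu>) * \<theta> \<le> - \<theta> * (U \<omega> - \<mu>)}"
    using \<theta> by (auto simp: abs_if mult.commute[of _ \<theta>] minus_mult_right simp del: mult_minus_right split: if_splits)
  then have "prob {\<omega> \<in> space M. 2 * sqrt (K * \<nu>) \<le> \<bar>U \<omega> - \<mu>\<bar>}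
      \<le> prob ({\<omega> \<in> space M. 2 * sqrt (K * \<nu>) * \<theta> \<le> \<theta> * (U \<omega> - \<mu>)}
        \<union> {\<omega> \<in> space M. 2 * sqrt (K * \<nu>) * \<theta> \<le> - \<theta> * (U \<omega> - \<mu>)})"
    by (intro finite_measure_mono sets.Un ev)
  also have "\<dots> \<le> prob {\<omega> \<in> space M. 2 * sqrt (K * \<nu>) * \<theta> \<le> \<theta> * (U \<omega> - \<mu>)}
        + prob {\<omega> \<in> space M. 2 * sqrt (K * \<nu>) * \<theta> \<le> - \<theta> * (U \<omega> - \<mu>)}"
    by (intro measure_Un_le ev)
  also have "\<dots> \<le> 2 * exp (- K)"
    using tail[of \<theta>] tail[of "-\<theta>"] by simp
  finally show ?thesis by (simp add: U_def \<mu>_def)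
qed

end

section \<open>Numerical estimate and union bound over degrees and times\<close>

lemma deviation_bound:
  fixes L \<psi> s t l :: real
  assumes "1 \<le> L" "0 \<le> t" "0 \<le> s" "s \<le> \<psi>" "1 \<le> \<psi>" "0 < l"
  shows "2 * sqrt (3 * L * (2 * t / l\<^sup>2 + s + 3 * L)) + s + 1
    \<le> 45 * (sqrt (t * L) / l) + 4 * 10 ^ 9 * \<psi> * L ^ 7"
proof -
  define x where "x = sqrt (t * L) / l"
  have x: "0 \<le> x" "x\<^sup>2 = t * L / l\<^sup>2" using assms by (auto simp: x_def power_divide)
  have "3 * L * (2 * t / l\<^sup>2 + s + 3 * L) = 6 * x\<^sup>2 + 3 * L * (s + 3 * L)"
    unfolding x(2) by (simp add: algebra_simps)
  \<comment> \<open>The summands are bounded separately by \<open>(3 * x)\<^sup>2\<close> and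
    \<open>(s + 3 * L)\<^sup>2\<close>; the cross term is non-negative.\<close>
  also have "\<dots> \<le> (3 * x + (s + 3 * L))\<^sup>2"
  proof -
    have "0 \<le> 3 * x\<^sup>2 + 6 * x * (s + 3 * L) + s * (s + 3 * L)" using x(1) assms by simp
    then show ?thesis by (simp add: power2_eq_square algebra_simps)
  qed
  finally have "sqrt (3 * L * (2 * t / l\<^sup>2 + s + 3 * L)) \<le> 3 * x + (s + 3 * L)"
    using x(1) assms by (intro real_le_lsqrt) auto
  \<comment> \<open>Each of \<open>s\<close>, \<open>L\<close> and 1 is at most
    \<open>\<psi> * L ^ 7\<close>, so the constant leaves ample room.\<close>
  moreover have "3 * s + 6 * L + 1 \<le> 4 * 10 ^ 9 * \<psi> * L ^ 7"
  proof -
    have "L \<le> \<psi> * L ^ 7" "\<psi> \<le> \<psi> * L ^ 7"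
      using mult_mono[of 1 \<psi> L "L ^ 7"] mult_left_mono[of 1 "L ^ 7" \<psi>] power_increasing[of 1 7 L]
        one_le_power[of L 7] assms by auto
    moreover have "0 \<le> \<psi> * L ^ 7" using assms by simp
    ultimately have "3 * s + 6 * L + 1 \<le> 4000000000 * (\<psi> * L ^ 7)" using assms by linarith
    then show ?thesis by simp
  qed
  ultimately show ?thesis using x(1) unfolding x_def[symmetric] by linarith
qed

theorem theorem1p2:
  fixes M :: "'w measure"
    and \<tau>0 :: nat
    and \<psi> :: real
    and G0 :: "'v graph"
    and new :: "nat \<Rightarrow> 'v"
    and G :: "nat \<Rightarrow> 'w \<Rightarrow> 'v graph"
  assumes "\<tau>0 \<ge> 4"
    and "\<psi> \<ge> max (real \<tau>0) (10 ^ 5 * sqrt (real \<tau>0 - 1) * ln (real \<tau>0) ^ 3)"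
    and "fin_graph G0" and "card (verts G0) = \<tau>0" and "size (edges G0) = \<tau>0 - 1"
    and "preferential_attachment M \<tau>0 G0 new G"
  shows "\<P>(\<omega> in M. \<forall>l\<ge>2. \<forall>t\<ge>\<tau>0.
      \<bar>real (num_deg_ge (G t \<omega>) l) - 2 * real t / (real l * (real l + 1))\<bar>
        \<le> 45 * (sqrt (real t * ln (\<psi> * real t)) / real l)
          + 4 * 10 ^ 9 * \<psi> * ln (\<psi> * real t) ^ 7) \<ge> 1 - 4 / \<psi>"
proof -
  interpret preferential_attachment M \<tau>0 G0 new G by fact
  define L where "L t = ln (\<psi> * real t)" for t
  define ok where "ok l t \<omega> \<longleftrightarrow> \<bar>real (num_deg_ge (G t \<omega>) l) - 2 * real t / (real l * (real l + 1))\<bar>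
        \<le> 45 * (sqrt (real t * L t) / real l) + 4 * 10 ^ 9 * \<psi> * L t ^ 7" for l t \<omega>
  \<comment> \<open>The first two terms bound the mean; adding \<open>3 * L t\<close> ensures
    \<open>K \<le> \<nu>\<close> for \<open>K = 3 * L t\<close>.\<close>
  define \<nu> where "\<nu> t l = 2 * real t / (real l)\<^sup>2 + real \<tau>0 + 3 * L t" for t l
  define \<mu> where "\<mu> t l = mean_count G0 \<tau>0 l (t - \<tau>0)" for t l
  define B where "B t l = {\<omega> \<in> space M. 2 * sqrt (3 * L t * \<nu> t l) \<le> \<bar>real (num_deg_ge (G t \<omega>) l) - \<mu> t l\<bar>}" for t l
  define Bad where "Bad n = (\<Union>l\<in>{2..2 * (\<tau>0 + n)}. B (\<tau>0 + n) l)" for n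
  have graph: "2 \<le> \<tau>0" "fin_graph G0" "Suc (size (edges G0)) = \<tau>0" using assms by auto
  have psi: "real \<tau>0 \<le> \<psi>" "4 \<le> \<psi>" using assms by auto
  have L: "1 \<le> L t" if "\<tau>0 \<le> t" for t
  proof -
    have "exp 1 \<le> (4::real) * 4" using exp_le by simp
    also have "\<dots> \<le> \<psi> * real t" using psi that assms(1) by (intro mult_mono) auto
    finally show ?thesis unfolding L_def by (subst ln_ge_iff) (use psi that assms(1) in auto)
  qed
  have mean: "\<bar>\<mu> t l - 2 * (real t - 1) / (real l * (real l + 1))\<bar> \<le> \<tau>0" if "\<tau>0 \<le> t" "2 \<le> l" for t l
    using mean_count_approx[of \<tau>0 G0 "l - 1" "t - \<tau>0"] that assms(1,4)
    by (auto simp: \<mu>_def of_nat_diff add.commute)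
  have r_le: "2 * (real t - 1) / (real l * (real l + 1)) \<le> 2 * real t / (real l)\<^sup>2" if "2 \<le> l" for t l :: nat
    using that by (intro frac_le) (auto simp: power2_eq_square)
  have B_event: "B t l \<in> events" if "\<tau>0 \<le> t" for t l
    unfolding B_def using that by (rule graph_event)
  \<comment> \<open>The factor 3 in \<open>K\<close> yields the cube: summing over at most
    \<open>2 * t\<close> degrees leaves order \<open>1 / t\<^sup>2\<close>, still summable over
    \<open>t\<close>.\<close>
  have prob_B: "prob (B t l) \<le> 2 / (\<psi> * t) ^ 3" if "\<tau>0 \<le> t" "2 \<le> l" for t l
  proof -
    have "\<mu> t l \<le> \<nu> t l" using mean[OF that] r_le[OF that(2), of t] L[OF that(1)] by (simp add: \<nu>_def)
    then have "prob (B t l) \<le> 2 * exp (- (3 * L t))"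
      using num_deg_ge_deviation[OF graph, of l "t - \<tau>0" "\<nu> t l" "3 * L t"] L[OF that(1)] that
      by (simp add: B_def \<mu>_def \<nu>_def)
    also have "exp (- (3 * L t)) = 1 / (\<psi> * t) ^ 3"
      using psi that assms(1) exp_of_nat_mult[of 3 "L t"] by (simp add: exp_minus L_def inverse_eq_divide)
    finally show ?thesis by simp
  qed
  have Bad_event: "Bad n \<in> events" for n unfolding Bad_def by (auto intro!: B_event)
  have prob_Bad: "prob (Bad n) \<le> 4 / \<psi> ^ 3 * (1 / (real n + 1)\<^sup>2)" for n
  proof -
    let ?t = "\<tau>0 + n"
    have "prob (Bad n) \<le> (\<Sum>l\<in>{2..2 * ?t}. prob (B ?t l))"
      unfolding Bad_def by (intro measure_UNION_le) (auto intro: B_event)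
    also have "\<dots> \<le> (\<Sum>l\<in>{2..2 * ?t}. 2 / (\<psi> * ?t) ^ 3)" by (intro sum_mono prob_B) auto
    also have "\<dots> \<le> (2 * real ?t) * (2 / (\<psi> * ?t) ^ 3)"
      using psi by (subst sum_constant) (intro mult_right_mono, auto)
    also have "\<dots> = 4 / \<psi> ^ 3 * (1 / (real ?t)\<^sup>2)"
    proof -
      have "(2 * x) * (2 / (\<psi> * x) ^ 3) = 4 / \<psi> ^ 3 * (1 / x\<^sup>2)" if "0 < x" for x
        using that psi by (simp add: field_simps power2_eq_square power3_eq_cube)
      from this[of "real ?t"] show ?thesis using assms(1) by (simp only: of_nat_0_less_iff)
    qed
    \<comment> \<open>\<open>\<tau>0 + n \<ge> n + 1\<close> allows comparison with the series of
      inverse squares.\<close>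
    also have "\<dots> \<le> 4 / \<psi> ^ 3 * (1 / (real n + 1)\<^sup>2)"
      using assms(1) psi by (intro mult_left_mono divide_left_mono power_mono) auto
    finally show ?thesis .
  qed
  have sums: "(\<lambda>n. 4 / \<psi> ^ 3 * (1 / (real n + 1)\<^sup>2)) sums (4 / \<psi> ^ 3 * (pi\<^sup>2 / 6))"
    using inverse_squares_sums by (intro sums_mult) (simp add: add.commute)
  have summ: "summable (\<lambda>n. prob (Bad n))"
    using prob_Bad by (intro summable_comparison_test'[OF sums_summable[OF sums]]) auto
  have "prob (\<Union>n. Bad n) \<le> (\<Sum>n. prob (Bad n))"
    using Bad_event by (intro finite_measure_subadditive_countably summ) auto
  also have "\<dots> \<le> 4 / \<psi> ^ 3 * (pi\<^sup>2 / 6)"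
    using suminf_le[OF prob_Bad summ sums_summable[OF sums]] sums_unique[OF sums] by simp
  also have "\<dots> \<le> 4 / \<psi> ^ 3 * \<psi>\<^sup>2"
  proof (intro mult_left_mono)
    have "pi\<^sup>2 \<le> 4\<^sup>2" using pi_less_4 by (intro power_mono) auto
    moreover have "4\<^sup>2 \<le> \<psi>\<^sup>2" using psi by (intro power_mono) auto
    ultimately show "pi\<^sup>2 / 6 \<le> \<psi>\<^sup>2" by simp
  qed (use psi in auto)
  also have "\<dots> = 4 / \<psi>" using psi by (simp add: power2_eq_square power3_eq_cube)
  finally have "1 - 4 / \<psi> \<le> prob (space M - (\<Union>n. Bad n))"
    using Bad_event by (subst prob_compl) auto
  also have "\<dots> \<le> prob {\<omega> \<in> space M. \<forall>l\<ge>2. \<forall>t\<ge>\<tau>0. ok l t \<omega>}"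
  \<comment> \<open>The inclusion holds only almost surely: for \<open>l > 2 * t\<close>, which
    \<open>Bad\<close> does not cover, it relies on the degree sum of a \<open>tree_like\<close>
    graph.\<close>
  proof (rule finite_measure_mono_AE)
    have "AE \<omega> in M. tree_like (\<tau>0 + n) (G (\<tau>0 + n) \<omega>)" for n
    proof -
      obtain S where S: "\<forall>g\<in>S. tree_like (\<tau>0 + n) g" "AE \<omega> in M. G (\<tau>0 + n) \<omega> \<in> S"
        using graph_AE[OF graph, of "\<tau>0 + n"] by auto
      from S(2) show ?thesis by eventually_elim (use S(1) in blast)
    qed
    then have "AE \<omega> in M. \<forall>n. tree_like (\<tau>0 + n) (G (\<tau>0 + n) \<omega>)" by (simp add: AE_all_countable)
    then show "AE \<omega> in M. \<omega> \<in> space M - (\<Union>n. Bad n) \<longrightarrow> \<omega> \<in> {\<omega> \<in> space M. \<forall>l\<ge>2. \<forall>t\<ge>\<tau>0. ok l t \<omega>}"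
    proof eventually_elim
      case (elim \<omega>)
      have "ok l t \<omega>" if \<omega>: "\<omega> \<in> space M - (\<Union>n. Bad n)" and lt: "2 \<le> l" "\<tau>0 \<le> t" for l t
      proof (cases "l \<le> 2 * t")
        case True
        have "\<omega> \<notin> Bad (t - \<tau>0)" using \<omega> by blast
        then have "\<omega> \<notin> B t l" using True lt by (auto simp: Bad_def)
        then have "\<bar>real (num_deg_ge (G t \<omega>) l) - \<mu> t l\<bar> \<le> 2 * sqrt (3 * L t * \<nu> t l)"
          using \<omega> by (auto simp: B_def)
        \<comment> \<open>The mean is approximated with \<open>t - 1\<close> in place of
          \<open>t\<close>; the shift costs at most 1, the final summand in
          \<open>deviation_bound\<close>.\<close>
        moreover have "2 * real t / (real l * (real l + 1)) = 2 * (real t - 1) / (real l * (real l + 1)) + 2 / (real l * (real l + 1))"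
          by (simp add: add_divide_distrib[symmetric])
        moreover have "0 \<le> 2 / (real l * (real l + 1))" "2 / (real l * (real l + 1)) \<le> 1"
          using lt mult_mono[of 2 "real l" 1 "real l + 1"] by (auto simp: divide_simps)
        ultimately have "\<bar>real (num_deg_ge (G t \<omega>) l) - 2 * real t / (real l * (real l + 1))\<bar>
            \<le> 2 * sqrt (3 * L t * \<nu> t l) + \<tau>0 + 1"
          using mean[OF lt(2,1)] by linarith
        also have "\<dots> \<le> 45 * (sqrt (real t * L t) / real l) + 4 * 10 ^ 9 * \<psi> * L t ^ 7"
          unfolding \<nu>_def using L[OF lt(2)] psi lt by (intro deviation_bound) auto
        finally show ?thesis by (simp add: ok_def)
      next
        case False
        have g: "tree_like t (G t \<omega>)" using elim[rule_format, of "t - \<tau>0"] lt by simp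
        have "vdegree (G t \<omega>) v < l" if "v \<in> verts (G t \<omega>)" for v
          using vdegree_le[OF _ that] g False by (force simp: tree_like_def)
        then have "num_deg_ge (G t \<omega>) l = 0" by (auto simp: num_deg_ge_def card_eq_0_iff not_le[symmetric])
        moreover have "2 * real t / (real l * (real l + 1)) \<le> 1"
        proof -
          have "2 * real t \<le> real l * 1" using False by simp
          also have "\<dots> \<le> real l * (real l + 1)" by (intro mult_left_mono) auto
          finally show ?thesis using lt by (simp add: divide_simps)
        qed
        moreover have "1 \<le> 4 * 10 ^ 9 * \<psi> * L t ^ 7"
          using mult_mono[of 1 \<psi> 1 "L t ^ 7"] one_le_power[OF L[OF lt(2)], of 7] psi by simp
        moreover have "0 \<le> 45 * (sqrt (real t * L t) / real l)" using L[OF lt(2)] by simp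
        ultimately show ?thesis by (simp add: ok_def)
      qed
      with AE_space show ?case by auto
    qed
    have ok_event: "{\<omega> \<in> space M. ok l t \<omega>} \<in> events" if "\<tau>0 \<le> t" for l t
      unfolding ok_def using that by (rule graph_event)
    have "{\<omega> \<in> space M. \<forall>l. \<forall>t. 2 \<le> l \<longrightarrow> \<tau>0 \<le> t \<longrightarrow> ok l t \<omega>} \<in> events"
    proof (intro sets.sets_Collect_countable_All)
      fix l t :: nat
      show "{\<omega> \<in> space M. 2 \<le> l \<longrightarrow> \<tau>0 \<le> t \<longrightarrow> ok l t \<omega>} \<in> events"
        using ok_event[of t l] by (cases "2 \<le> l \<and> \<tau>0 \<le> t") auto
    qed
    also have "{\<omega> \<in> space M. \<forall>l. \<forall>t. 2 \<le> l \<longrightarrow> \<tau>0 \<le> t \<longrightarrow> ok l t \<omega>}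
        = {\<omega> \<in> space M. \<forall>l\<ge>2. \<forall>t\<ge>\<tau>0. ok l t \<omega>}" by blast
    finally show "{\<omega> \<in> space M. \<forall>l\<ge>2. \<forall>t\<ge>\<tau>0. ok l t \<omega>} \<in> events" .
  qed
  finally show ?thesis unfolding ok_def L_def .
qed

end
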